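(* Fix a time slot $t$ and consider the joint transportation and charging scheduling problem (JTCSP) in time slot $t$: the game with player set $\mathcal{I}=\{1,\dots,I\}$, in which player $i$ chooses $x_{i,t}\in[0,1]$ to maximize $$u_{i,t}(x_{i,t}) = -(m_{i,t}x_{i,t}-d_{i,t})^2+\alpha_1 m_{i,t}\ln(2-x_{i,t})-\alpha_2 p_t m_{i,t}(1-x_{i,t}),$$ subject to the shared constraints $r\sum_{j\in\mathcal{I}} m_{j,t}(1-x_{j,t})=E^+_t$ and $\sum_{j\in\mathcal{I}} m_{j,t}x_{j,t}\ge d_t$. Assume that the joint feasible set $\Omega_t$ is nonempty. Then for every weight vector $\mathbf{w}_t=(w_{1,t},\dots,w_{I,t})$ with all $w_{i,t}>0$ there exists a unique normalized Nash equilibrium $\mathbf{x}_t\in\Omega_t$ with weights $\mathbf{w}_t$.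
   Context: Parameters: $I\ge 1$ is an integer; for each $i\in\mathcal{I}$, $m_{i,t}$ is a positive integer and $d_{i,t}\ge 0$; $d_t=\sum_{i\in\mathcal{I}} d_{i,t}$; $\alpha_1>0$, $\alpha_2>0$, $r>0$, $p_t\ge 0$ and $E^+_t\ge 0$ are given real constants (in particular $p_t$ does not depend on the strategies). Joint feasible set: $\Omega_t$ is the set of all $\mathbf{x}_t\in[0,1]^I$ with $r\sum_{j\in\mathcal{I}} m_{j,t}(1-x_{j,t})=E^+_t$ and $\sum_{j\in\mathcal{I}} m_{j,t}x_{j,t}\ge d_t$. All these constraints are collected in one vector inequality $\boldsymbol{\theta}(\mathbf{x}_t)\le 0$ with affine components: the equality is written as the two inequalities $\pm\big(r\sum_j m_{j,t}(1-x_{j,t})-E^+_t\big)\le 0$, together with $d_t-\sum_j m_{j,t}x_{j,t}\le 0$ and $-x_{j,t}\le 0$, $x_{j,t}-1\le 0$ for all $j\in\mathcal{I}$. Thus $\Omega_t=\{\mathbf{x}_t:\boldsymbol{\theta}(\mathbf{x}_t)\le 0\}$. Normalized Nash equilibrium (NNE) with weights $\mathbf{w}_t$: a point $\mathbf{x}_t\in\Omega_t$ for which there is a vector $\bar{\boldsymbol{\lambda}}_t$ (one entry per component of $\boldsymbol{\theta}$) such that, putting $\boldsymbol{\lambda}_{i,t}=\bar{\boldsymbol{\lambda}}_t/w_{i,t}$, the following hold for every $i\in\mathcal{I}$: $-w_{i,t}\nabla_{x_{i,t}}u_{i,t}+\boldsymbol{\lambda}_{i,t}^T\nabla_{x_{i,t}}\boldsymbol{\theta}(\mathbf{x}_t)=0$;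 $\boldsymbol{\lambda}_{i,t}^T\boldsymbol{\theta}(\mathbf{x}_t)=0$; $\boldsymbol{\lambda}_{i,t}\ge 0$; $\boldsymbol{\theta}(\mathbf{x}_t)\le 0$. Uniqueness refers to the point $\mathbf{x}_t$, not to the multipliers. *)

theory Defs
  imports "HOL-Analysis.Analysis"
begin

text \<open>The time slot is fixed, so the index \<open>t\<close> is dropped throughout. The player set is the
  finite type \<open>'n\<close> (so the number of players is \<open>CARD('n)\<close>, which is at least 1), and a strategy
  profile is a vector \<open>x :: real ^ 'n\<close>.\<close>

definition utility ::
  "('n \<Rightarrow> nat) \<Rightarrow> ('n \<Rightarrow> real) \<Rightarrow> real \<Rightarrow> real \<Rightarrow> real \<Rightarrow> 'n \<Rightarrow> real \<Rightarrow> real" where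
  "utility m d \<alpha>1 \<alpha>2 p i s =
     - (real (m i) * s - d i)\<^sup>2 + \<alpha>1 * real (m i) * ln (2 - s) - \<alpha>2 * p * real (m i) * (1 - s)"

definition feasible_set ::
  "('n::finite \<Rightarrow> nat) \<Rightarrow> ('n \<Rightarrow> real) \<Rightarrow> real \<Rightarrow> real \<Rightarrow> (real ^ 'n) set" where
  "feasible_set m d r E =
     {x. (\<forall>j. x $ j \<in> {0..1})
       \<and> r * (\<Sum>j\<in>UNIV. real (m j) * (1 - x $ j)) = E
       \<and> (\<Sum>j\<in>UNIV. real (m j) * x $ j) \<ge> (\<Sum>j\<in>UNIV. d j)}"

text \<open>Index type for the components of the constraint map: the two inequalities encoding the
  energy equality, the demand constraint, and the lower and upper bound of each player.\<close>

datatype 'n cidx = EnergyLe | EnergyGe | Demand | Lower 'n | Upper 'n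

lemma UNIV_cidx: "UNIV = {EnergyLe, EnergyGe, Demand} \<union> range Lower \<union> range Upper"
proof -
  have "c \<in> {EnergyLe, EnergyGe, Demand} \<union> range Lower \<union> range Upper" for c :: "'n cidx"
    by (cases c) auto
  then show ?thesis by blast
qed

instance cidx :: (finite) finite
  by standard (simp add: UNIV_cidx)

primrec constraint ::
  "('n::finite \<Rightarrow> nat) \<Rightarrow> ('n \<Rightarrow> real) \<Rightarrow> real \<Rightarrow> real \<Rightarrow> real ^ 'n \<Rightarrow> 'n cidx \<Rightarrow> real" where
  "constraint m d r E x EnergyLe = r * (\<Sum>j\<in>UNIV. real (m j) * (1 - x $ j)) - E"
| "constraint m d r E x EnergyGe = - (r * (\<Sum>j\<in>UNIV. real (m j) * (1 - x $ j)) - E)"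
| "constraint m d r E x Demand = (\<Sum>j\<in>UNIV. d j) - (\<Sum>j\<in>UNIV. real (m j) * x $ j)"
| "constraint m d r E x (Lower j) = - (x $ j)"
| "constraint m d r E x (Upper j) = x $ j - 1"

definition theta ::
  "('n::finite \<Rightarrow> nat) \<Rightarrow> ('n \<Rightarrow> real) \<Rightarrow> real \<Rightarrow> real \<Rightarrow> real ^ 'n \<Rightarrow> real ^ 'n cidx" where
  "theta m d r E x = (\<chi> c. constraint m d r E x c)"

lemma feasible_set_eq: "feasible_set m d r E = {x. theta m d r E x \<le> 0}"
proof -
  have all_cidx: "(\<forall>c. P c) \<longleftrightarrow>
      P EnergyLe \<and> P EnergyGe \<and> P Demand \<and> (\<forall>j. P (Lower j)) \<and> (\<forall>j. P (Upper j))"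
    for P :: "'a cidx \<Rightarrow> bool"
    by (metis cidx.exhaust)
  show ?thesis
    by (auto simp: feasible_set_def theta_def less_eq_vec_def all_cidx)
qed

definition partial_grad :: "(real ^ 'n \<Rightarrow> real ^ 'k) \<Rightarrow> 'n \<Rightarrow> real ^ 'n \<Rightarrow> real ^ 'k" where
  "partial_grad F i x = (\<chi> c. deriv (\<lambda>s. F (\<chi> j. if j = i then s else x $ j) $ c) (x $ i))"

text \<open>The utility of player \<open>i\<close> depends only on the
  player's own strategy, so its gradient in that strategy is an ordinary derivative. The weight
  enters twice: as a factor of the utility gradient and through the multiplier \<open>\<Lambda> / w i\<close>.\<close>

definition normalized_nash ::
  "('n::finite \<Rightarrow> nat) \<Rightarrow> ('n \<Rightarrow> real) \<Rightarrow> real \<Rightarrow> real \<Rightarrow> real \<Rightarrow> real \<Rightarrow> real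
    \<Rightarrow> ('n \<Rightarrow> real) \<Rightarrow> real ^ 'n \<Rightarrow> bool" where
  "normalized_nash m d \<alpha>1 \<alpha>2 r p E w x \<longleftrightarrow>
     x \<in> feasible_set m d r E \<and>
     (\<exists>\<Lambda> :: real ^ 'n cidx. \<forall>i.
        (let \<mu> = (1 / w i) *\<^sub>R \<Lambda> in
           - w i * deriv (utility m d \<alpha>1 \<alpha>2 p i) (x $ i)
             + \<mu> \<bullet> partial_grad (theta m d r E) i x = 0
         \<and> \<mu> \<bullet> theta m d r E x = 0
         \<and> \<mu> \<ge> 0
         \<and> theta m d r E x \<le> 0))"

end

theory Submission
  imports Defs
begin

text \<open>Multiplying the stationarity condition of player \<open>i\<close> by \<open>w i\<close> gives
  \<open>\<Lambda> \<bullet> \<nabla>\<^sub>i \<theta> = (w i)\<^sup>2 u\<^sub>i'(x\<^sub>i)\<close>. As \<open>\<theta>\<close> is affine, the normalized equilibria are exactly the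
  solutions of the variational inequality \<open>\<Sum>\<^sub>i (w i)\<^sup>2 u\<^sub>i'(x\<^sub>i) (y\<^sub>i - x\<^sub>i) \<le> 0\<close> for all feasible \<open>y\<close>.
  A maximizer of \<open>\<Sum>\<^sub>i (w i)\<^sup>2 u\<^sub>i\<close> on the compact convex feasible set solves it, and the solution is
  unique because every \<open>u\<^sub>i'\<close> is strictly decreasing. Multipliers for a solution are found
  explicitly: the energy equality makes the demand constraint redundant, and moving charge between
  two players shows that a single price \<open>\<nu>\<close> separates the marginal values
  \<open>(w i)\<^sup>2 u\<^sub>i'(x\<^sub>i) / m i\<close> of the players that can decrease from those of the players that can
  increase.\<close>

section \<open>Marginal utilities\<close>

definition marginal_utility ::
  "('n \<Rightarrow> nat) \<Rightarrow> ('n \<Rightarrow> real) \<Rightarrow> real \<Rightarrow> real \<Rightarrow> real \<Rightarrow> 'n \<Rightarrow> real \<Rightarrow> real" where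
  "marginal_utility m d \<alpha>1 \<alpha>2 p i s =
     - 2 * real (m i) * (real (m i) * s - d i) - \<alpha>1 * real (m i) / (2 - s) + \<alpha>2 * p * real (m i)"

lemma has_real_derivative_utility:
  assumes "s < 2"
  shows "(utility m d \<alpha>1 \<alpha>2 p i has_real_derivative marginal_utility m d \<alpha>1 \<alpha>2 p i s) (at s)"
  unfolding utility_def marginal_utility_def
  using assms by (auto intro!: derivative_eq_intros simp: field_simps)

text \<open>Strictness is drawn from the quadratic term, whose derivative has slope
  \<open>- 2 * (real (m i))\<^sup>2\<close>. The logarithmic term is only compared weakly; there
  \<open>t < 2\<close> keeps both denominators positive.\<close>

lemma marginal_utility_strict_antimono:
  assumes "m i > 0" and "\<alpha>1 > 0" and "s < t" and "t < 2"
  shows "marginal_utility m d \<alpha>1 \<alpha>2 p i t < marginal_utility m d \<alpha>1 \<alpha>2 p i s"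
proof -
  have "\<alpha>1 * real (m i) / (2 - s) \<le> \<alpha>1 * real (m i) / (2 - t)"
    using assms by (intro divide_left_mono) auto
  moreover have "2 * real (m i) * (real (m i) * s - d i) < 2 * real (m i) * (real (m i) * t - d i)"
    using assms by (intro mult_strict_left_mono) auto
  ultimately show ?thesis
    unfolding marginal_utility_def by linarith
qed

section \<open>The affine constraint map and its gradient\<close>

primrec constraint_coeff :: "('n \<Rightarrow> nat) \<Rightarrow> real \<Rightarrow> 'n cidx \<Rightarrow> 'n \<Rightarrow> real" where
  "constraint_coeff m r EnergyLe i = - (r * real (m i))"
| "constraint_coeff m r EnergyGe i = r * real (m i)"
| "constraint_coeff m r Demand i = - real (m i)"
| "constraint_coeff m r (Lower j) i = (if i = j then - 1 else 0)"
| "constraint_coeff m r (Upper j) i = (if i = j then 1 else 0)"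

text \<open>For an affine map the first-order expansion is exact, with a constant gradient. The base
  point is arbitrary, so the same identity yields the partial derivatives, convexity of the feasible
  set and the comparison of two feasible points.\<close>

lemma constraint_affine:
  "constraint m d r E y c =
     constraint m d r E x c + (\<Sum>i\<in>UNIV. constraint_coeff m r c i * (y $ i - x $ i))"
  by (cases c)
    (simp_all add: if_distrib if_distribR sum.delta algebra_simps sum_subtractf sum_distrib_left
      sum.distrib sum_negf cong: if_cong)

lemma partial_grad_theta:
  "partial_grad (theta m d r E) i x $ c = constraint_coeff m r c i"
proof -
  have "theta m d r E (\<chi> j. if j = i then s else x $ j) $ c =
      theta m d r E x $ c + constraint_coeff m r c i * (s - x $ i)" for s
  proof -
    have "(\<Sum>k\<in>UNIV. constraint_coeff m r c k * ((\<chi> j. if j = i then s else x $ j) $ k - x $ k))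
        = (\<Sum>k\<in>UNIV. if k = i then constraint_coeff m r c i * (s - x $ i) else 0)"
      by (intro sum.cong) auto
    then show ?thesis
      unfolding theta_def vec_lambda_beta
      by (subst constraint_affine[of m d r E _ c x]) simp
  qed
  moreover have "((\<lambda>s. theta m d r E x $ c + constraint_coeff m r c i * (s - x $ i))
      has_real_derivative constraint_coeff m r c i) (at (x $ i))"
    by (auto intro!: derivative_eq_intros)
  ultimately show ?thesis
    unfolding partial_grad_def vec_lambda_beta by (simp only: DERIV_imp_deriv)
qed

lemma sum_cidx:
  fixes f :: "'n::finite cidx \<Rightarrow> 'a::comm_monoid_add"
  shows "(\<Sum>c\<in>UNIV. f c) = f EnergyLe + f EnergyGe + f Demand
    + (\<Sum>j\<in>UNIV. f (Lower j)) + (\<Sum>j\<in>UNIV. f (Upper j))"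
proof -
  have "(\<Sum>c\<in>UNIV. f c) = (\<Sum>c\<in>{EnergyLe, EnergyGe, Demand}. f c)
      + sum f (range Lower) + sum f (range Upper)"
  proof -
    have "sum f (({EnergyLe, EnergyGe, Demand} \<union> range Lower) \<union> range Upper)
        = sum f ({EnergyLe, EnergyGe, Demand} \<union> range Lower) + sum f (range Upper)"
      by (rule sum.union_disjoint) auto
    moreover have "sum f ({EnergyLe, EnergyGe, Demand} \<union> range Lower)
        = (\<Sum>c\<in>{EnergyLe, EnergyGe, Demand}. f c) + sum f (range Lower)"
      by (rule sum.union_disjoint) auto
    ultimately show ?thesis
      unfolding UNIV_cidx by simp
  qed
  moreover have "sum f (range Lower) = (\<Sum>j\<in>UNIV. f (Lower j))"
    and "sum f (range Upper) = (\<Sum>j\<in>UNIV. f (Upper j))"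
    by (subst sum.reindex; auto simp: inj_on_def)+
  ultimately show ?thesis
    by (simp add: add.assoc)
qed

section \<open>Compactness and convexity of the feasible set\<close>

lemma compact_feasible_set: "compact (feasible_set m d r E)"
proof -
  have "feasible_set m d r E = (\<Inter>c. {x. constraint m d r E x c \<le> 0})"
    unfolding feasible_set_eq by (auto simp: theta_def less_eq_vec_def)
  moreover have "closed {x. constraint m d r E x c \<le> 0}" for c
    by (cases c) (auto intro!: closed_Collect_le continuous_intros)
  ultimately have "closed (feasible_set m d r E)"
    by auto
  moreover have "bounded (feasible_set m d r E)"
    by (rule bounded_subset[of "cbox 0 1"])
      (auto simp: feasible_set_def mem_box_cart)
  ultimately show ?thesis
    by (simp add: compact_eq_bounded_closed)
qed

lemma convex_feasible_set: "convex (feasible_set m d r E)"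
proof (rule convexI)
  fix x y and u v :: real
  assume x: "x \<in> feasible_set m d r E" and y: "y \<in> feasible_set m d r E"
    and uv: "0 \<le> u" "0 \<le> v" "u + v = 1"
  have u: "u = 1 - v" using uv by simp
  have "constraint m d r E (u *\<^sub>R x + v *\<^sub>R y) c
      = u * constraint m d r E x c + v * constraint m d r E y c" for c
  proof -
    have "(\<Sum>i\<in>UNIV. constraint_coeff m r c i * ((u *\<^sub>R x + v *\<^sub>R y) $ i - x $ i))
        = v * (\<Sum>i\<in>UNIV. constraint_coeff m r c i * (y $ i - x $ i))"
      unfolding sum_distrib_left by (intro sum.cong) (auto simp: u algebra_simps)
    then show ?thesis
      using constraint_affine[of m d r E "u *\<^sub>R x + v *\<^sub>R y" c x]
        constraint_affine[of m d r E y c x]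
      by (simp only:) (simp add: u algebra_simps)
  qed
  moreover have "constraint m d r E x c \<le> 0" "constraint m d r E y c \<le> 0" for c
    using x y unfolding feasible_set_eq by (auto simp: theta_def less_eq_vec_def)
  ultimately show "u *\<^sub>R x + v *\<^sub>R y \<in> feasible_set m d r E"
    unfolding feasible_set_eq using uv
    by (auto simp: theta_def less_eq_vec_def add_nonpos_nonpos mult_nonneg_nonpos)
qed

section \<open>Multipliers and the variational inequality\<close>

text \<open>Dividing by \<open>w i > 0\<close> changes neither the signs of the multipliers nor
  complementarity, so these conditions become independent of the player; the weight survives only in
  stationarity, squared. Multipliers become plain functions so that they can later be defined by
  cases.\<close>

lemma normalized_nash_iff:
  assumes "\<And>i. w i > 0"
  shows "normalized_nash m d \<alpha>1 \<alpha>2 r p E w x \<longleftrightarrow> x \<in> feasible_set m d r E \<and>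
    (\<exists>\<Lambda>. (\<forall>c. \<Lambda> c \<ge> 0) \<and> (\<Sum>c\<in>UNIV. \<Lambda> c * constraint m d r E x c) = 0 \<and>
      (\<forall>i. (\<Sum>c\<in>UNIV. \<Lambda> c * constraint_coeff m r c i)
        = (w i)\<^sup>2 * marginal_utility m d \<alpha>1 \<alpha>2 p i (x $ i)))"
proof (cases "x \<in> feasible_set m d r E")
  case True
  have D: "deriv (utility m d \<alpha>1 \<alpha>2 p i) (x $ i) = marginal_utility m d \<alpha>1 \<alpha>2 p i (x $ i)" for i
    using True by (intro DERIV_imp_deriv has_real_derivative_utility)
      (auto simp: feasible_set_def intro: le_less_trans[of _ 1])
  have th: "theta m d r E x \<le> 0"
    using True unfolding feasible_set_eq by simp
  have w: "w i \<noteq> 0" for i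
    using assms[of i] by simp
  have stat: "- w i * D + ((1 / w i) *\<^sub>R \<Lambda>) \<bullet> partial_grad (theta m d r E) i x = 0
      \<longleftrightarrow> (\<Sum>c\<in>UNIV. \<Lambda> $ c * constraint_coeff m r c i) = (w i)\<^sup>2 * D" for i D \<Lambda>
    using w[of i] by (simp add: inner_vec_def partial_grad_theta field_simps power2_eq_square
        flip: sum_distrib_left sum_divide_distrib)
  have comp: "((1 / w i) *\<^sub>R \<Lambda>) \<bullet> theta m d r E x = 0
      \<longleftrightarrow> (\<Sum>c\<in>UNIV. \<Lambda> $ c * constraint m d r E x c) = 0" for i \<Lambda>
    using w[of i] by (simp add: inner_vec_def theta_def flip: sum_divide_distrib)
  have nonneg: "(1 / w i) *\<^sub>R \<Lambda> \<ge> 0 \<longleftrightarrow> (\<forall>c. \<Lambda> $ c \<ge> 0)" for i and \<Lambda> :: "real ^ 'a cidx"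
    using assms[of i] by (simp add: less_eq_vec_def zero_le_divide_iff)
  have vec: "(\<exists>\<Lambda> :: real ^ 'a cidx. P (($) \<Lambda>)) \<longleftrightarrow> (\<exists>\<Lambda>. P \<Lambda>)" for P
    by (metis vec_lambda_inverse UNIV_I)
  show ?thesis
    unfolding normalized_nash_def Let_def D stat comp nonneg
    using True th by (subst vec[symmetric]) auto
next
  case False
  then show ?thesis by (simp add: normalized_nash_def)
qed

text \<open>The minimum of \<open>A\<close> separates, or the maximum of \<open>B\<close> if
  \<open>A\<close> is empty; if both are empty, any real does.\<close>

lemma exists_separating_real:
  fixes A B :: "real set"
  assumes "finite A" and "finite B" and "\<And>a b. a \<in> A \<Longrightarrow> b \<in> B \<Longrightarrow> b \<le> a"
  shows "\<exists>\<nu>. (\<forall>a\<in>A. \<nu> \<le> a) \<and> (\<forall>b\<in>B. b \<le> \<nu>)"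
proof (cases "A = {}")
  case True
  then show ?thesis
    using assms(2) by (cases "B = {}") (auto intro: exI[of _ "Max B"])
next
  case False
  then show ?thesis
    using assms by (intro exI[of _ "Min A"]) auto
qed

lemma variational_inequality_price:
  fixes m :: "'n::finite \<Rightarrow> nat"
  assumes m: "\<And>i. m i > 0" and x: "x \<in> feasible_set m d r E"
    and vi: "\<And>y. y \<in> feasible_set m d r E \<Longrightarrow> (\<Sum>i\<in>UNIV. h i * (y $ i - x $ i)) \<le> 0"
  shows "\<exists>\<nu>. \<forall>i. (x $ i > 0 \<longrightarrow> \<nu> * real (m i) \<le> h i) \<and> (x $ i < 1 \<longrightarrow> h i \<le> \<nu> * real (m i))"
proof -
  have box: "0 \<le> x $ i" "x $ i \<le> 1" for i
    using x by (auto simp: feasible_set_def)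
  have exchange: "h j / real (m j) \<le> h i / real (m i)" if i: "x $ i > 0" and j: "x $ j < 1" for i j
  proof (cases "i = j")
    case False
    \<comment> \<open>The largest amount of weighted charge that can pass from player
      \<open>i\<close> to player \<open>j\<close> within their bounds; \<open>a\<close> and
      \<open>b\<close> are the resulting changes of strategy.\<close>
    define \<epsilon> where "\<epsilon> = min (real (m i) * x $ i) (real (m j) * (1 - x $ j))"
    define a b where "a = \<epsilon> / real (m i)" and "b = \<epsilon> / real (m j)"
    have \<epsilon>: "\<epsilon> > 0"
      using i j m by (auto simp: \<epsilon>_def)
    have ab: "0 < a" "a \<le> x $ i" "0 < b" "b \<le> 1 - x $ j" "real (m i) * a = \<epsilon>" "real (m j) * b = \<epsilon>"
      using \<epsilon> m[of i] m[of j] by (auto simp: a_def b_def \<epsilon>_def field_simps)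
    define y where "y = (\<chi> k. x $ k + (if k = j then b else 0) - (if k = i then a else 0))"
    have diff: "(\<Sum>k\<in>UNIV. f k * (y $ k - x $ k)) = f j * b - f i * a" for f :: "'n \<Rightarrow> real"
    proof -
      have "(\<Sum>k\<in>UNIV. f k * (y $ k - x $ k))
          = (\<Sum>k\<in>UNIV. (if k = j then f j * b else 0) - (if k = i then f i * a else 0))"
        by (intro sum.cong) (auto simp: y_def algebra_simps)
      then show ?thesis
        by (simp add: sum_subtractf)
    qed
    \<comment> \<open>Both shared constraints depend on the profile only through this weighted sum,
      so preserving it and the bounds preserves feasibility.\<close>
    have "(\<Sum>k\<in>UNIV. real (m k) * y $ k) = (\<Sum>k\<in>UNIV. real (m k) * x $ k)"
      using diff[of "\<lambda>k. real (m k)"] ab by (simp add: algebra_simps sum_subtractf)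
    moreover have "0 \<le> y $ k \<and> y $ k \<le> 1" for k
      using ab box[of k] False by (auto simp: y_def)
    ultimately have "y \<in> feasible_set m d r E"
      using x by (simp add: feasible_set_def right_diff_distrib sum_subtractf)
    from vi[OF this] have "\<epsilon> * (h j / real (m j)) \<le> \<epsilon> * (h i / real (m i))"
      by (simp add: diff a_def b_def mult.commute)
    then show ?thesis
      by (rule mult_left_le_imp_le[OF _ \<epsilon>])
  qed simp
  obtain \<nu> where \<nu>: "\<forall>a \<in> (\<lambda>i. h i / real (m i)) ` {i. x $ i > 0}. \<nu> \<le> a"
    "\<forall>b \<in> (\<lambda>i. h i / real (m i)) ` {i. x $ i < 1}. b \<le> \<nu>"
    using exists_separating_real[of "(\<lambda>i. h i / real (m i)) ` {i. x $ i > 0}"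
        "(\<lambda>i. h i / real (m i)) ` {i. x $ i < 1}"] exchange by auto
  then show ?thesis
    using m by (intro exI[of _ \<nu>]) (auto simp: field_simps)
qed

lemma normalized_nash_iff_variational_inequality:
  fixes m :: "'n::finite \<Rightarrow> nat"
  assumes m: "\<And>i. m i > 0" and r: "r > 0" and w: "\<And>i. w i > 0"
  shows "normalized_nash m d \<alpha>1 \<alpha>2 r p E w x \<longleftrightarrow> x \<in> feasible_set m d r E \<and>
    (\<forall>y \<in> feasible_set m d r E.
      (\<Sum>i\<in>UNIV. (w i)\<^sup>2 * marginal_utility m d \<alpha>1 \<alpha>2 p i (x $ i) * (y $ i - x $ i)) \<le> 0)"
    (is "_ \<longleftrightarrow> _ \<and> (\<forall>y \<in> _. (\<Sum>i\<in>UNIV. ?h i * _ y i) \<le> 0)")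
proof (intro iffI conjI ballI)
  assume "normalized_nash m d \<alpha>1 \<alpha>2 r p E w x"
  then obtain \<Lambda> where x: "x \<in> feasible_set m d r E" and pos: "\<And>c. \<Lambda> c \<ge> 0"
    and comp: "(\<Sum>c\<in>UNIV. \<Lambda> c * constraint m d r E x c) = 0"
    and stat: "\<And>i. (\<Sum>c\<in>UNIV. \<Lambda> c * constraint_coeff m r c i) = ?h i"
    unfolding normalized_nash_iff[OF w] by auto
  show "x \<in> feasible_set m d r E" by fact
  fix y assume y: "y \<in> feasible_set m d r E"
  \<comment> \<open>Weighting the exact expansions of the constraints by the multipliers turns the
    sum into the weighted constraints at \<open>y\<close> minus those at \<open>x\<close>. The
    former are nonpositive, the latter vanish by complementarity.\<close>
  have "(\<Sum>i\<in>UNIV. ?h i * (y $ i - x $ i))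
      = (\<Sum>i\<in>UNIV. \<Sum>c\<in>UNIV. \<Lambda> c * (constraint_coeff m r c i * (y $ i - x $ i)))"
    by (simp add: sum_distrib_right mult.assoc flip: stat)
  also have "\<dots> = (\<Sum>c\<in>UNIV. \<Lambda> c * (\<Sum>i\<in>UNIV. constraint_coeff m r c i * (y $ i - x $ i)))"
    by (subst sum.swap) (simp add: sum_distrib_left)
  also have "\<dots> = (\<Sum>c\<in>UNIV. \<Lambda> c * constraint m d r E y c) - (\<Sum>c\<in>UNIV. \<Lambda> c * constraint m d r E x c)"
    by (subst constraint_affine[of m d r E y _ x]) (simp add: algebra_simps sum.distrib)
  also have "\<dots> \<le> 0"
    using y pos unfolding comp feasible_set_eq
    by (auto simp: theta_def less_eq_vec_def intro!: sum_nonpos mult_nonneg_nonpos)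
  finally show "(\<Sum>i\<in>UNIV. ?h i * (y $ i - x $ i)) \<le> 0" .
next
  assume "x \<in> feasible_set m d r E \<and> (\<forall>y \<in> feasible_set m d r E.
      (\<Sum>i\<in>UNIV. ?h i * (y $ i - x $ i)) \<le> 0)"
  then have x: "x \<in> feasible_set m d r E"
    and vi: "\<And>y. y \<in> feasible_set m d r E \<Longrightarrow> (\<Sum>i\<in>UNIV. ?h i * (y $ i - x $ i)) \<le> 0"
    by auto
  obtain \<nu> where \<nu>: "\<And>i. x $ i > 0 \<Longrightarrow> \<nu> * real (m i) \<le> ?h i"
    "\<And>i. x $ i < 1 \<Longrightarrow> ?h i \<le> \<nu> * real (m i)"
    using variational_inequality_price[OF m x vi] by auto
  have box: "0 \<le> x $ i" "x $ i \<le> 1" for i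
    using x by (auto simp: feasible_set_def)
  \<comment> \<open>The energy gradients are \<open>- (r * real (m i))\<close> and
    \<open>r * real (m i)\<close>, so the negative and positive parts of \<open>\<nu>\<close>,
    divided by \<open>r\<close>, together contribute \<open>\<nu> * real (m i)\<close>. The bound
    multipliers supply the remainder \<open>?h i - \<nu> * real (m i)\<close>, split by
    sign.\<close>
  define \<Lambda> where "\<Lambda> c = (case c of EnergyLe \<Rightarrow> max (- \<nu>) 0 / r | EnergyGe \<Rightarrow> max \<nu> 0 / r
    | Demand \<Rightarrow> 0 | Lower i \<Rightarrow> max (\<nu> * real (m i) - ?h i) 0
    | Upper i \<Rightarrow> max (?h i - \<nu> * real (m i)) 0)" for c
  have "\<Lambda> c \<ge> 0" for c
    using r by (simp add: \<Lambda>_def split: cidx.split)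
  \<comment> \<open>At an inactive bound the price inequality for \<open>\<nu>\<close> forces the
    corresponding positive part to be 0.\<close>
  moreover have "\<Lambda> c * constraint m d r E x c = 0" for c
  proof (cases c)
    case (Lower i)
    show ?thesis
    proof (cases "x $ i = 0")
      case False
      then show ?thesis
        using \<nu>(1)[of i] box[of i] by (simp add: Lower \<Lambda>_def)
    qed (simp add: Lower)
  next
    case (Upper i)
    show ?thesis
    proof (cases "x $ i = 1")
      case False
      then show ?thesis
        using \<nu>(2)[of i] box[of i] by (simp add: Upper \<Lambda>_def)
    qed (simp add: Upper)
  qed (use x in \<open>simp_all add: \<Lambda>_def feasible_set_def\<close>)
  moreover have "(\<Sum>c\<in>UNIV. \<Lambda> c * constraint_coeff m r c i) = ?h i" for i
    using r by (simp add: sum_cidx \<Lambda>_def if_distrib[of "(*) _"] cong: if_cong) (simp add: max_def)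
  ultimately show "normalized_nash m d \<alpha>1 \<alpha>2 r p E w x"
    unfolding normalized_nash_iff[OF w] using x by (intro conjI exI[of _ \<Lambda>] sum.neutral) auto
qed

section \<open>Existence and uniqueness of the equilibrium\<close>

text \<open>This is the first-order necessary condition at a maximizer of the
  \<open>v\<close>-weighted sum of utilities: by convexity the segment towards any feasible
  \<open>y\<close> stays feasible, so the directional derivative there cannot be positive.\<close>

lemma variational_inequality_solution_exists:
  fixes m :: "'n::finite \<Rightarrow> nat"
  assumes "feasible_set m d r E \<noteq> {}"
  shows "\<exists>x \<in> feasible_set m d r E. \<forall>y \<in> feasible_set m d r E.
    (\<Sum>i\<in>UNIV. v i * marginal_utility m d \<alpha>1 \<alpha>2 p i (x $ i) * (y $ i - x $ i)) \<le> 0"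
proof -
  let ?\<Omega> = "feasible_set m d r E"
  let ?u = "utility m d \<alpha>1 \<alpha>2 p"
  define F where "F z = (\<Sum>i\<in>UNIV. v i * ?u i (z $ i))" for z :: "real ^ 'n"
  have lt2: "z $ i < 2" if "z \<in> ?\<Omega>" for z i
    using that by (auto simp: feasible_set_def intro: le_less_trans[of _ 1])
  have "continuous_on ?\<Omega> F"
    unfolding F_def utility_def using lt2
    by (intro continuous_intros) (auto simp: less_imp_neq[symmetric] dest: lt2)
  then obtain x where x: "x \<in> ?\<Omega>" and max: "\<And>y. y \<in> ?\<Omega> \<Longrightarrow> F y \<le> F x"
    using continuous_attains_sup[OF compact_feasible_set assms] by blast
  show ?thesis
  proof (intro bexI[OF _ x] ballI, rule ccontr)
    fix y assume y: "y \<in> ?\<Omega>"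
    let ?D = "\<Sum>i\<in>UNIV. v i * marginal_utility m d \<alpha>1 \<alpha>2 p i (x $ i) * (y $ i - x $ i)"
    assume "\<not> ?D \<le> 0"
    then have D: "?D > 0" by simp
    define \<phi> where "\<phi> s = F ((1 - s) *\<^sub>R x + s *\<^sub>R y)" for s
    have "((\<lambda>s. v i * ?u i ((1 - s) * x $ i + s * y $ i)) has_real_derivative
        v i * (marginal_utility m d \<alpha>1 \<alpha>2 p i (x $ i) * (y $ i - x $ i))) (at 0)" for i
      using lt2[OF x, of i]
      by (intro DERIV_cmult DERIV_chain2[of "?u i"] has_real_derivative_utility)
        (auto intro!: derivative_eq_intros has_real_derivative_utility)
    then have "(\<phi> has_real_derivative ?D) (at 0)"
      unfolding \<phi>_def F_def by (auto intro!: DERIV_sum simp: mult.assoc)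
    then obtain \<delta> where \<delta>: "\<delta> > 0" "\<And>h. 0 < h \<Longrightarrow> h < \<delta> \<Longrightarrow> \<phi> 0 < \<phi> (0 + h)"
      using DERIV_pos_inc_right[OF _ D] by blast
    \<comment> \<open>Halving puts \<open>h\<close> strictly below \<open>\<delta>\<close>; the cap
      at 1 keeps the point on the segment from \<open>x\<close> to \<open>y\<close>.\<close>
    define h where "h = min (\<delta> / 2) 1"
    have h: "0 < h" "h < \<delta>" "h \<le> 1"
      using \<delta>(1) by (auto simp: h_def)
    have "(1 - h) *\<^sub>R x + h *\<^sub>R y \<in> ?\<Omega>"
      using convexD[OF convex_feasible_set x y, of "1 - h" h] h by simp
    then have "\<phi> h \<le> \<phi> 0"
      using max by (simp add: \<phi>_def)
    with \<delta>(2)[of h] h show False by simp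
  qed
qed

theorem theoremV1:
  fixes m :: "'n::finite \<Rightarrow> nat" and d :: "'n \<Rightarrow> real"
    and \<alpha>1 \<alpha>2 r p E :: real and w :: "'n \<Rightarrow> real"
  assumes "\<And>i. m i > 0" and "\<And>i. d i \<ge> 0"
    and "\<alpha>1 > 0" and "\<alpha>2 > 0" and "r > 0" and "p \<ge> 0" and "E \<ge> 0"
    and "feasible_set m d r E \<noteq> {}"
    and "\<And>i. w i > 0"
  shows "\<exists>!x. normalized_nash m d \<alpha>1 \<alpha>2 r p E w x"
proof -
  note iff = normalized_nash_iff_variational_inequality
    [of m r w d \<alpha>1 \<alpha>2 p E, OF assms(1) assms(5) assms(9)]
  show ?thesis
  proof (rule ex_ex1I)
    show "\<exists>x. normalized_nash m d \<alpha>1 \<alpha>2 r p E w x"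
      unfolding iff
      using variational_inequality_solution_exists[OF assms(8), of "\<lambda>i. (w i)\<^sup>2" \<alpha>1 \<alpha>2 p] by blast
  next
    fix x y
    assume nx: "normalized_nash m d \<alpha>1 \<alpha>2 r p E w x" and ny: "normalized_nash m d \<alpha>1 \<alpha>2 r p E w y"
    let ?h = "\<lambda>i s. (w i)\<^sup>2 * marginal_utility m d \<alpha>1 \<alpha>2 p i s"
    \<comment> \<open>\<open>?g i\<close> is the sum of the \<open>i\<close>-th terms of two
      variational inequalities: the one at \<open>x\<close> tested with \<open>y\<close>, and the
      one at \<open>y\<close> tested with \<open>x\<close>. Strict decrease of the marginal utility
      makes it positive wherever the two equilibria differ.\<close>
    let ?g = "\<lambda>i. (?h i (x $ i) - ?h i (y $ i)) * (y $ i - x $ i)"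
    have feas: "x \<in> feasible_set m d r E" "y \<in> feasible_set m d r E"
      using nx ny unfolding iff by auto
    have lt2: "x $ i < 2" "y $ i < 2" for i
      using feas by (auto simp: feasible_set_def intro: le_less_trans[of _ 1])
    have pos: "?g i > 0" if "x $ i \<noteq> y $ i" for i
    proof -
      note anti = marginal_utility_strict_antimono[of m i \<alpha>1 _ _ d \<alpha>2 p, OF assms(1) assms(3)]
      have w2: "(w i)\<^sup>2 > 0" using assms(9)[of i] by simp
      from that consider "x $ i < y $ i" | "y $ i < x $ i" by linarith
      then show ?thesis
      proof cases
        case 1
        then show ?thesis
          using anti[OF 1 lt2(2)] w2 by (intro mult_pos_pos) auto
      next
        case 2
        then show ?thesis
          using anti[OF 2 lt2(1)] w2 by (intro mult_neg_neg) auto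
      qed
    qed
    then have nonneg: "?g i \<ge> 0" for i
      by (cases "x $ i = y $ i") (auto intro: less_imp_le)
    have "(\<Sum>i\<in>UNIV. ?h i (x $ i) * (y $ i - x $ i)) \<le> 0"
      and "(\<Sum>i\<in>UNIV. ?h i (y $ i) * (x $ i - y $ i)) \<le> 0"
      using nx ny feas unfolding iff by auto
    then have "(\<Sum>i\<in>UNIV. ?g i) \<le> 0"
      by (simp add: algebra_simps sum.distrib sum_subtractf)
    \<comment> \<open>A sum of nonnegative terms that is at most 0 has only zero terms, so the
      equilibria agree in every coordinate.\<close>
    then have "(\<Sum>i\<in>UNIV. ?g i) = 0"
      using nonneg by (intro antisym sum_nonneg) auto
    then have "?g i = 0" for i
      using nonneg by (subst (asm) sum_nonneg_eq_0_iff) auto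
    then show "x = y"
      using pos by (metis less_irrefl vec_eq_iff)
  qed
qed

end
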